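(* Let $P$ be a finite poset and $A \subseteq P$ a subposet with $\min(P)\cup\max(P)\subseteq A$. For integral-valued order preserving maps $\lambda : A \to \mathbb{Z}$ let \[ \Omega_{P,A}(\lambda) \;=\; \bigl|\mathcal{O}_{P,A}(\lambda)\cap \mathbb{Z}^P\bigr|. \] Then $\Omega_{P,A}$ is a piecewise polynomial over the order cone $\mathcal{O}(A)$, and the cells of the canonical subdivision of $\mathcal{O}(A)$ refine its domains of polynomiality. That is, for every chain of order ideals $\mathcal{I}$ of $A$ there is a polynomial $p_{\mathcal{I}} \in \mathbb{R}[x_a : a\in A]$ such that $\Omega_{P,A}(\lambda) = p_{\mathcal{I}}(\lambda)$ for all $\lambda \in F(\mathcal{I})\cap\mathbb{Z}^A$.
   Context: A map $\phi$ from a poset $Q$ to $\mathbb{R}$ is order preserving if $\phi(p)\le\phi(q)$ whenever $p\preceq q$. $\min(P)$ and $\max(P)$ are the sets of minimal and maximal elements of $P$. For an order preserving $\lambda: A\to\mathbb{R}$, the marked order polytope is $\mathcal{O}_{P,A}(\lambda)=\{\phi\in\mathbb{R}^P : \phi \text{ order preserving},\ \phi(a)=\lambda(a)\ \forall a\in A\}$. The order cone $\mathcal{O}(A)\subseteq\mathbb{R}^A$ is the set of all order preserving maps $A\to\mathbb{R}$. A chain of order ideals of $A$ is a sequence $\mathcal{I}: \emptyset\neq I_0\subsetneq I_1\subsetneq\cdots\subsetneq I_k=A$ of order ideals (down-closed subsets) of $A$; its cell $F(\mathcal{I})\subseteq\mathbb{R}^A$ is the set of $\phi$ that are constant on each $I_j\setminus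 I_{j-1}$ ($I_{-1}=\emptyset$) with $\phi(I_0)\le\phi(I_1\setminus I_0)\le\cdots\le\phi(I_k\setminus I_{k-1})$ (the closure of the set where these inequalities are strict). The cells $F(\mathcal{I})$ over all chains of order ideals form the canonical subdivision of $\mathcal{O}(A)$ into unimodular simplicial cones. *)

theory Defs
  imports Complex_Main "HOL-Library.FuncSet" "HOL-Library.Poly_Mapping"
begin

text \<open>
  A finite poset is a finite subset of an ordered type, with the induced order; the vector space
  of real functions on it is the set of extensional functions \<open>P \<rightarrow>\<^sub>E UNIV\<close>, with
  lattice \<open>P \<rightarrow>\<^sub>E \<int>\<close>.
\<close>

definition min_elems :: "'a::order set \<Rightarrow> 'a set" where
  "min_elems P = {x \<in> P. \<forall>y\<in>P. y \<le> x \<longrightarrow> y = x}"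

definition max_elems :: "'a::order set \<Rightarrow> 'a set" where
  "max_elems P = {x \<in> P. \<forall>y\<in>P. x \<le> y \<longrightarrow> y = x}"

definition marked_order_polytope :: "'a::order set \<Rightarrow> 'a set \<Rightarrow> ('a \<Rightarrow> real) \<Rightarrow> ('a \<Rightarrow> real) set" where
  "marked_order_polytope P A l = {\<phi> \<in> P \<rightarrow>\<^sub>E UNIV. mono_on P \<phi> \<and> (\<forall>a\<in>A. \<phi> a = l a)}"

definition order_cone :: "'a::order set \<Rightarrow> ('a \<Rightarrow> real) set" where
  "order_cone A = {\<phi> \<in> A \<rightarrow>\<^sub>E UNIV. mono_on A \<phi>}"

definition Omega :: "'a::order set \<Rightarrow> 'a set \<Rightarrow> ('a \<Rightarrow> real) \<Rightarrow> nat" where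
  "Omega P A l = card (marked_order_polytope P A l \<inter> (P \<rightarrow>\<^sub>E \<int>))"

definition order_ideal :: "'a::order set \<Rightarrow> 'a set \<Rightarrow> bool" where
  "order_ideal A I \<longleftrightarrow> I \<subseteq> A \<and> (\<forall>x\<in>I. \<forall>y\<in>A. y \<le> x \<longrightarrow> y \<in> I)"

text \<open>Only the values \<open>I 0, \<dots>, I k\<close> of \<open>I\<close> matter.\<close>

definition ideal_chain :: "'a::order set \<Rightarrow> nat \<Rightarrow> (nat \<Rightarrow> 'a set) \<Rightarrow> bool" where
  "ideal_chain A k I \<longleftrightarrow>
     I 0 \<noteq> {} \<and> (\<forall>j\<le>k. order_ideal A (I j)) \<and> (\<forall>j<k. I j \<subset> I (Suc j)) \<and> I k = A"

definition block :: "(nat \<Rightarrow> 'a set) \<Rightarrow> nat \<Rightarrow> 'a set" where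
  "block I j = (case j of 0 \<Rightarrow> I 0 | Suc i \<Rightarrow> I (Suc i) - I i)"

text \<open>The number \<open>c j\<close> is the common value of \<open>\<phi>\<close> on the \<open>j\<close>-th block.\<close>

definition cell :: "'a set \<Rightarrow> nat \<Rightarrow> (nat \<Rightarrow> 'a set) \<Rightarrow> ('a \<Rightarrow> real) set" where
  "cell A k I = {\<phi> \<in> A \<rightarrow>\<^sub>E UNIV.
     \<exists>c. (\<forall>j\<le>k. \<forall>a\<in>block I j. \<phi> a = c j) \<and> (\<forall>j<k. c j \<le> c (Suc j))}"

text \<open>
  Real polynomials in variables indexed by \<open>'a\<close> are finitely supported maps from monomials to
  coefficients, a monomial being its finitely supported exponent vector.
\<close>

type_synonym 'a mpolynomial = "('a \<Rightarrow>\<^sub>0 nat) \<Rightarrow>\<^sub>0 real"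

definition polynomials_over :: "'a set \<Rightarrow> 'a mpolynomial set" where
  "polynomials_over A = {p. \<forall>m\<in>Poly_Mapping.keys p. Poly_Mapping.keys m \<subseteq> A}"

definition poly_eval :: "'a mpolynomial \<Rightarrow> ('a \<Rightarrow> real) \<Rightarrow> real" where
  "poly_eval p x = (\<Sum>m\<in>Poly_Mapping.keys p. Poly_Mapping.lookup p m *
     (\<Prod>a\<in>Poly_Mapping.keys m. x a ^ Poly_Mapping.lookup m a))"

definition polyhedral_cone :: "'a set \<Rightarrow> ('a \<Rightarrow> real) set \<Rightarrow> bool" where
  "polyhedral_cone A C \<longleftrightarrow>
     (\<exists>H :: ('a \<Rightarrow> real) set. finite H \<and>
        C = {x \<in> A \<rightarrow>\<^sub>E UNIV. \<forall>h\<in>H. 0 \<le> (\<Sum>a\<in>A. h a * x a)})"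

text \<open>
  The function \<open>f\<close> is only of interest at lattice points, so it is required to agree with a
  polynomial at the lattice points of each piece.
\<close>

definition piecewise_polynomial_over ::
    "'a set \<Rightarrow> ('a \<Rightarrow> real) set \<Rightarrow> (('a \<Rightarrow> real) \<Rightarrow> real) \<Rightarrow> bool" where
  "piecewise_polynomial_over A C f \<longleftrightarrow>
     (\<exists>\<D>. finite \<D> \<and> \<Union>\<D> = C \<and>
        (\<forall>D\<in>\<D>. polyhedral_cone A D \<and>
           (\<exists>p\<in>polynomials_over A. \<forall>x\<in>D \<inter> (A \<rightarrow>\<^sub>E \<int>). f x = poly_eval p x)))"

text \<open>The cardinality in \<^const>\<open>Omega\<close> is that of a finite set.\<close>

lemma finite_lattice_points:
  assumes fin: "finite P" and sub: "A \<subseteq> P" and mm: "min_elems P \<union> max_elems P \<subseteq> A"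
  shows "finite (marked_order_polytope P A l \<inter> (P \<rightarrow>\<^sub>E \<int>))"
proof (rule finite_subset)
  have fA: "finite A" using fin sub finite_subset by blast
  show "finite (P \<rightarrow>\<^sub>E {r \<in> \<int>. Min (l ` A) \<le> r \<and> r \<le> Max (l ` A)})"
    using fin finite_int_segment by (intro finite_PiE) auto
  show "marked_order_polytope P A l \<inter> (P \<rightarrow>\<^sub>E \<int>) \<subseteq> P \<rightarrow>\<^sub>E {r \<in> \<int>. Min (l ` A) \<le> r \<and> r \<le> Max (l ` A)}"
  proof
    fix \<phi> assume "\<phi> \<in> marked_order_polytope P A l \<inter> (P \<rightarrow>\<^sub>E \<int>)"
    then have Z: "\<phi> \<in> P \<rightarrow>\<^sub>E \<int>" and mono: "mono_on P \<phi>" and mark: "\<And>a. a \<in> A \<Longrightarrow> \<phi> a = l a"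
      by (auto simp: marked_order_polytope_def)
    have "Min (l ` A) \<le> \<phi> x \<and> \<phi> x \<le> Max (l ` A)" if x: "x \<in> P" for x
    proof -
      obtain m where m: "m \<in> P" "m \<le> x" "\<forall>y\<in>P. y \<le> m \<longrightarrow> m = y"
        using finite_has_minimal2[OF fin x] by blast
      obtain n where n: "n \<in> P" "x \<le> n" "\<forall>y\<in>P. n \<le> y \<longrightarrow> n = y"
        using finite_has_maximal2[OF fin x] by blast
      have mn: "m \<in> A" "n \<in> A" using m n mm by (auto simp: min_elems_def max_elems_def)
      have "\<phi> m \<le> \<phi> x" "\<phi> x \<le> \<phi> n"
        using mono m(1,2) n(1,2) x by (auto simp: mono_on_def)
      moreover have "Min (l ` A) \<le> \<phi> m" "\<phi> n \<le> Max (l ` A)"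
        using mn fA mark by auto
      ultimately show ?thesis by linarith
    qed
    then show "\<phi> \<in> P \<rightarrow>\<^sub>E {r \<in> \<int>. Min (l ` A) \<le> r \<and> r \<le> Max (l ` A)}"
      using Z by (auto simp: PiE_iff)
  qed
qed

end

theory Submission
  imports Defs
begin

text \<open>
  Sorting \<open>A\<close> by the values of an order preserving map, with ties broken compatibly with the order,
  gives a linear extension of \<open>A\<close>; hence the order cone is covered by the chambers of the linear
  extensions, and every cell lies in one of them. On a chamber, \<open>Omega\<close> is computed by induction on the
  number of unmarked elements. An unmarked \<open>p\<close> takes a value between \<open>l (xs ! i)\<close> and
  \<open>l (xs ! j)\<close>, where \<open>xs ! i\<close> is the last marked element below \<open>p\<close> and \<open>xs ! j\<close> the first one
  above it. Cutting this range at the intermediate marked values into half-open pieces, and marking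
  \<open>p\<close> as well, the sum over each piece is a sum of values of one polynomial, so it is
  polynomial in the end points, and it vanishes as it should if the end points coincide.
\<close>

section \<open>Polynomial functions\<close>

text \<open>The products are generated one variable at a time, so an induction meets no product of
  two unknown functions. Formal polynomials enter only afterwards, through
  \<open>polyfun_poly_eval\<close>.\<close>

inductive_set polyfun :: "'a set \<Rightarrow> (('a \<Rightarrow> real) \<Rightarrow> real) set" for A where
  const: "(\<lambda>_. c) \<in> polyfun A"
| add: "f \<in> polyfun A \<Longrightarrow> g \<in> polyfun A \<Longrightarrow> (\<lambda>x. f x + g x) \<in> polyfun A"
| times_var: "f \<in> polyfun A \<Longrightarrow> a \<in> A \<Longrightarrow> (\<lambda>x. x a * f x) \<in> polyfun A"

lemma polyfun_var: "a \<in> A \<Longrightarrow> (\<lambda>x. x a) \<in> polyfun A"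
  using polyfun.times_var[OF polyfun.const[of 1]] by simp

lemma polyfun_mult:
  assumes "f \<in> polyfun A" "g \<in> polyfun A"
  shows "(\<lambda>x. f x * g x) \<in> polyfun A"
  using assms(1)
proof induction
  case (const c)
  show ?case using assms(2)
  proof induction
    case (const d)
    then show ?case by (rule polyfun.const)
  next
    case (add f g)
    then show ?case using polyfun.add[OF add.IH] by (simp add: algebra_simps)
  next
    case (times_var f a)
    then show ?case using polyfun.times_var[OF times_var.IH] by (simp add: algebra_simps)
  qed
next
  case (add f h)
  then show ?case using polyfun.add[OF add.IH] by (simp add: algebra_simps)
next
  case (times_var f a)
  then show ?case using polyfun.times_var[OF times_var.IH] by (simp add: algebra_simps)
qed

lemma polyfun_diff:
  assumes "f \<in> polyfun A" "g \<in> polyfun A"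
  shows "(\<lambda>x. f x - g x) \<in> polyfun A"
  using polyfun.add[OF assms(1) polyfun_mult[OF polyfun.const[of "-1"] assms(2)]] by simp

lemma polyfun_mono: "f \<in> polyfun A \<Longrightarrow> A \<subseteq> B \<Longrightarrow> f \<in> polyfun B"
  by (induction rule: polyfun.induct) (auto intro: polyfun.intros)

lemma polyfun_fun_upd: "f \<in> polyfun A \<Longrightarrow> p \<notin> A \<Longrightarrow> f (x(p := v)) = f x"
  by (induction rule: polyfun.induct) auto

text \<open>Trades the variable \<open>p\<close> for the marked value \<open>x a\<close>. An
  antidifference in \<open>p\<close> is evaluated in this way at the ends of a summation
  range.\<close>

lemma polyfun_subst:
  assumes "f \<in> polyfun (insert p A)" "a \<in> A"
  shows "(\<lambda>x. f (x(p := x a))) \<in> polyfun A"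
  using assms(1)
proof induction
  case (times_var f b)
  then show ?case using polyfun.times_var[OF times_var.IH] assms(2) by (cases "b = p") auto
qed (auto intro: polyfun.intros)

section \<open>Discrete summation in one variable\<close>

lemma polyfun_gchoose: "a \<in> A \<Longrightarrow> (\<lambda>x. x a gchoose k) \<in> polyfun A"
proof (induction k)
  case 0
  then show ?case by (simp add: polyfun.const)
next
  case (Suc k)
  have eq: "(y gchoose Suc k) = (y - real k) * (1 / real (Suc k)) * (y gchoose k)" for y :: real
    using gbinomial_mult_1[of y k] by (simp add: field_simps)
  show ?case unfolding eq
    using Suc by (intro polyfun_mult polyfun_diff polyfun_var polyfun.const)
qed

text \<open>The basis \<open>x p gchoose k\<close> of the polynomials in the variable \<open>p\<close> is used because its
  discrete antidifference is \<open>x p gchoose Suc k\<close>.\<close>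

inductive_set gchoose_span :: "'a set \<Rightarrow> 'a \<Rightarrow> (('a \<Rightarrow> real) \<Rightarrow> real) set" for A p where
  base: "c \<in> polyfun A \<Longrightarrow> (\<lambda>x. c x * (x p gchoose k)) \<in> gchoose_span A p"
| add: "f \<in> gchoose_span A p \<Longrightarrow> g \<in> gchoose_span A p \<Longrightarrow> (\<lambda>x. f x + g x) \<in> gchoose_span A p"

text \<open>For the variable \<open>p\<close>, the identity \<open>y * (y gchoose k) = k * (y
  gchoose k) + (k + 1) * (y gchoose (k + 1))\<close> re-expands the product in the basis. Any other
  variable is absorbed into the coefficient.\<close>

lemma gchoose_span_times_var:
  assumes "f \<in> gchoose_span A p" "a \<in> insert p A"
  shows "(\<lambda>x. x a * f x) \<in> gchoose_span A p"
  using assms(1)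
proof induction
  case (base c k)
  show ?case
  proof (cases "a = p")
    case True
    have "(\<lambda>x. (real k * c x) * (x p gchoose k)) \<in> gchoose_span A p"
      "(\<lambda>x. (real (Suc k) * c x) * (x p gchoose Suc k)) \<in> gchoose_span A p"
      by (intro gchoose_span.base polyfun_mult polyfun.const base)+
    from gchoose_span.add[OF this]
    have "(\<lambda>x. c x * (real k * (x p gchoose k) + real (Suc k) * (x p gchoose Suc k))) \<in> gchoose_span A p"
      by (simp add: algebra_simps)
    then show ?thesis
      unfolding gbinomial_mult_1[symmetric] True by (simp add: mult.left_commute)
  next
    case False
    then have "(\<lambda>x. (x a * c x) * (x p gchoose k)) \<in> gchoose_span A p"
      using assms(2) base by (intro gchoose_span.base polyfun.times_var) auto
    then show ?thesis by (simp add: mult.assoc)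
  qed
next
  case (add f g)
  then show ?case using gchoose_span.add[OF add.IH] by (simp add: algebra_simps)
qed

text \<open>Newton expansion in \<open>p\<close>: a constant is a multiple of
  \<open>x p gchoose 0\<close>, and the span is closed under the other two generating rules.\<close>

lemma polyfun_gchoose_span:
  assumes "f \<in> polyfun (insert p A)"
  shows "f \<in> gchoose_span A p"
  using assms
proof induction
  case (const c)
  then show ?case using gchoose_span.base[OF polyfun.const[of c], where k = 0] by simp
qed (auto intro: gchoose_span.add gchoose_span_times_var)

text \<open>By Pascal's rule, \<open>gchoose Suc k\<close> is an antidifference of
  \<open>gchoose k\<close>. The coefficient passes through because \<open>p \<notin> A\<close> makes
  it independent of the value at \<open>p\<close>.\<close>

lemma gchoose_span_antidifference:
  assumes "f \<in> gchoose_span A p" "p \<notin> A"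
  shows "\<exists>h\<in>polyfun (insert p A). \<forall>x v. h (x(p := v + 1)) - h (x(p := v)) = f (x(p := v))"
  using assms(1)
proof induction
  case (base c k)
  have "(\<lambda>x. c x * (x p gchoose Suc k)) \<in> polyfun (insert p A)"
    using base by (intro polyfun_mult polyfun_gchoose) (auto intro: polyfun_mono)
  moreover have "c (x(p := v + 1)) * (v + 1 gchoose Suc k) - c (x(p := v)) * (v gchoose Suc k)
      = c (x(p := v)) * (v gchoose k)" for x v
    using gbinomial_Suc_Suc[of v k] by (simp add: polyfun_fun_upd[OF base assms(2)] algebra_simps)
  ultimately show ?case by (intro bexI[of _ "\<lambda>x. c x * (x p gchoose Suc k)"]) (auto simp del: fun_upd_apply simp: fun_upd_same)
next
  case (add f g)
  then obtain h h' where h: "h \<in> polyfun (insert p A)" "h' \<in> polyfun (insert p A)"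
    "\<And>x v. h (x(p := v + 1)) - h (x(p := v)) = f (x(p := v))"
    "\<And>x v. h' (x(p := v + 1)) - h' (x(p := v)) = g (x(p := v))"
    by blast
  then show ?case
    by (intro bexI[of _ "\<lambda>x. h x + h' x"]) (auto intro: polyfun.add simp del: fun_upd_apply simp flip: h(3,4))
qed

lemma sum_int_telescope:
  fixes h :: "int \<Rightarrow> real"
  assumes "m \<le> n"
  shows "(\<Sum>v\<in>{m..<n}. h (v + 1) - h v) = h n - h m"
  using assms
proof (induction n rule: int_ge_induct)
  case (step n)
  have "{m..<n + 1} = insert n {m..<n}" using step by auto
  then show ?case using step by simp
qed simp

text \<open>With an antidifference \<open>h\<close> the sum telescopes to \<open>h\<close> at the
  two ends, where \<open>x a\<close> and \<open>x b\<close> replace \<open>p\<close>. If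
  \<open>x a = x b\<close>, the empty sum and this difference are both zero, so one formula also
  covers degenerate ranges.\<close>

lemma polyfun_sum:
  assumes "f \<in> polyfun (insert p A)" "p \<notin> A" "a \<in> A" "b \<in> A"
  shows "\<exists>F\<in>polyfun A. \<forall>x. x a \<in> \<int> \<longrightarrow> x b \<in> \<int> \<longrightarrow> x a \<le> x b \<longrightarrow>
    (\<Sum>v\<in>{\<lfloor>x a\<rfloor>..<\<lfloor>x b\<rfloor>}. f (x(p := of_int v))) = F x"
proof -
  obtain h where h: "h \<in> polyfun (insert p A)"
    and diff: "\<And>x v. h (x(p := v + 1)) - h (x(p := v)) = f (x(p := v))"
    using gchoose_span_antidifference[OF polyfun_gchoose_span[OF assms(1)] assms(2)] by blast
  have "(\<Sum>v\<in>{\<lfloor>x a\<rfloor>..<\<lfloor>x b\<rfloor>}. f (x(p := of_int v))) = h (x(p := x b)) - h (x(p := x a))"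
    if "x a \<in> \<int>" "x b \<in> \<int>" "x a \<le> x b" for x
  proof -
    have "(\<Sum>v\<in>{\<lfloor>x a\<rfloor>..<\<lfloor>x b\<rfloor>}. f (x(p := of_int v)))
      = (\<Sum>v\<in>{\<lfloor>x a\<rfloor>..<\<lfloor>x b\<rfloor>}. h (x(p := of_int (v + 1))) - h (x(p := of_int v)))"
      by (simp add: diff)
    also have "\<dots> = h (x(p := of_int \<lfloor>x b\<rfloor>)) - h (x(p := of_int \<lfloor>x a\<rfloor>))"
      using that by (intro sum_int_telescope floor_mono)
    finally show ?thesis using that by simp
  qed
  then show ?thesis
    using h assms by (intro bexI[of _ "\<lambda>x. h (x(p := x b)) - h (x(p := x a))"] polyfun_diff polyfun_subst) auto
qed

section \<open>From polynomial functions to formal polynomials\<close>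

lemma poly_eval_superset:
  assumes "finite K" "Poly_Mapping.keys p \<subseteq> K"
  shows "poly_eval p x = (\<Sum>m\<in>K. Poly_Mapping.lookup p m *
     (\<Prod>a\<in>Poly_Mapping.keys m. x a ^ Poly_Mapping.lookup m a))"
  unfolding poly_eval_def using assms
  by (intro sum.mono_neutral_left) (auto simp: in_keys_iff)

lemma poly_eval_zero: "poly_eval 0 x = 0"
  by (simp add: poly_eval_def)

lemma poly_eval_add: "poly_eval (p + q) x = poly_eval p x + poly_eval q x"
proof -
  let ?K = "Poly_Mapping.keys p \<union> Poly_Mapping.keys q"
  show ?thesis
    using Poly_Mapping.keys_add[of p q]
    by (simp add: poly_eval_superset[of ?K] lookup_add algebra_simps sum.distrib)
qed

lemma poly_eval_sum: "poly_eval (\<Sum>i\<in>S. p i) x = (\<Sum>i\<in>S. poly_eval (p i) x)"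
  by (induction S rule: infinite_finite_induct) (auto simp: poly_eval_zero poly_eval_add)

lemma poly_eval_single:
  "poly_eval (Poly_Mapping.single m c) x =
    c * (\<Prod>a\<in>Poly_Mapping.keys m. x a ^ Poly_Mapping.lookup m a)"
  by (subst poly_eval_superset[of "{m}"]) auto

lemma monomial_eval_add_single:
  fixes x :: "'a \<Rightarrow> real"
  shows "(\<Prod>b\<in>Poly_Mapping.keys (m + Poly_Mapping.single a (1 :: nat)).
      x b ^ Poly_Mapping.lookup (m + Poly_Mapping.single a 1) b)
    = x a * (\<Prod>b\<in>Poly_Mapping.keys m. x b ^ Poly_Mapping.lookup m b)"
proof -
  \<comment> \<open>A common index set for both products: if \<open>a\<close> is missing from
    \<open>keys m\<close>, it contributes the harmless factor \<open>x a ^ 0\<close>.\<close>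
  let ?K = "insert a (Poly_Mapping.keys m)"
  have "(\<Prod>b\<in>Poly_Mapping.keys (m + Poly_Mapping.single a 1).
      x b ^ Poly_Mapping.lookup (m + Poly_Mapping.single a 1) b)
    = (\<Prod>b\<in>?K. x b ^ Poly_Mapping.lookup (m + Poly_Mapping.single a 1) b)"
    using Poly_Mapping.keys_add[of m "Poly_Mapping.single a 1"]
    by (intro prod.mono_neutral_left) (auto simp: in_keys_iff)
  also have "\<dots> = (\<Prod>b\<in>?K. x b ^ Poly_Mapping.lookup m b * (if b = a then x a else 1))"
    by (intro prod.cong) (auto simp: lookup_add lookup_single power_add)
  also have "\<dots> = (\<Prod>b\<in>?K. x b ^ Poly_Mapping.lookup m b) * x a"
    by (simp add: prod.distrib prod.delta)
  also have "(\<Prod>b\<in>?K. x b ^ Poly_Mapping.lookup m b)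
    = (\<Prod>b\<in>Poly_Mapping.keys m. x b ^ Poly_Mapping.lookup m b)"
    by (intro prod.mono_neutral_right) (auto simp: in_keys_iff)
  finally show ?thesis by (simp add: mult.commute)
qed

lemma polynomials_over_add:
  "p \<in> polynomials_over A \<Longrightarrow> q \<in> polynomials_over A \<Longrightarrow> p + q \<in> polynomials_over A"
  using Poly_Mapping.keys_add[of p q] by (auto simp: polynomials_over_def)

lemma polynomials_over_sum:
  "(\<And>i. i \<in> S \<Longrightarrow> p i \<in> polynomials_over A) \<Longrightarrow> (\<Sum>i\<in>S. p i) \<in> polynomials_over A"
proof (induction S rule: infinite_finite_induct)
  case (insert i S)
  then show ?case by (simp add: polynomials_over_add)
qed (auto simp: polynomials_over_def)

lemma polynomials_over_single:
  "Poly_Mapping.keys m \<subseteq> A \<Longrightarrow> Poly_Mapping.single m c \<in> polynomials_over A"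
  by (auto simp: polynomials_over_def)

lemma polyfun_poly_eval:
  assumes "f \<in> polyfun A"
  shows "\<exists>p\<in>polynomials_over A. \<forall>x. f x = poly_eval p x"
  using assms
proof induction
  case (const c)
  show ?case
    by (intro bexI[of _ "Poly_Mapping.single 0 c"] polynomials_over_single)
      (auto simp: poly_eval_single)
next
  case (add f g)
  then obtain p q where "p \<in> polynomials_over A" "q \<in> polynomials_over A"
    "\<And>x. f x = poly_eval p x" "\<And>x. g x = poly_eval q x"
    by blast
  then show ?case
    by (intro bexI[of _ "p + q"]) (auto simp: poly_eval_add polynomials_over_add)
next
  case (times_var f a)
  then obtain p where p: "p \<in> polynomials_over A" "\<And>x. f x = poly_eval p x"
    by blast
  \<comment> \<open>The formal product of the variable \<open>a\<close> and \<open>p\<close>: the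
    exponent of \<open>a\<close> goes up by one in every monomial.\<close>
  define q where "q = (\<Sum>m\<in>Poly_Mapping.keys p.
    Poly_Mapping.single (m + Poly_Mapping.single a 1) (Poly_Mapping.lookup p m))"
  have "Poly_Mapping.keys (m + Poly_Mapping.single a (1::nat)) \<subseteq> A" if "m \<in> Poly_Mapping.keys p" for m
    using Poly_Mapping.keys_add[of m "Poly_Mapping.single a (1::nat)"] p(1) that times_var
    by (auto simp: polynomials_over_def split: if_splits)
  then have "q \<in> polynomials_over A"
    unfolding q_def by (intro polynomials_over_sum polynomials_over_single)
  moreover have "poly_eval q x = x a * f x" for x
    unfolding q_def poly_eval_sum poly_eval_single monomial_eval_add_single p(2)
    by (simp add: poly_eval_def sum_distrib_left mult_ac)
  ultimately show ?case by (intro bexI[of _ q]) auto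
qed

section \<open>Chambers of linear extensions\<close>

text \<open>Excluding \<open>b \<le> a\<close> for \<open>a\<close> listed before \<open>b\<close>
  forbids reversals and repetitions at once, so distinctness is a consequence.\<close>

definition linear_extension :: "'a::order set \<Rightarrow> 'a list \<Rightarrow> bool" where
  "linear_extension A xs \<longleftrightarrow> set xs = A \<and> sorted_wrt (\<lambda>a b. \<not> b \<le> a) xs"

definition chamber :: "'a set \<Rightarrow> 'a list \<Rightarrow> ('a \<Rightarrow> real) set" where
  "chamber A xs = {x \<in> A \<rightarrow>\<^sub>E UNIV. sorted (map x xs)}"

lemma linear_extension_distinct: "linear_extension A xs \<Longrightarrow> distinct xs"
proof -
  have "sorted_wrt (\<lambda>a b. \<not> b \<le> a) xs \<Longrightarrow> distinct xs" by (induction xs) auto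
  then show "linear_extension A xs \<Longrightarrow> distinct xs" by (simp add: linear_extension_def)
qed

lemma finite_linear_extensions: "finite A \<Longrightarrow> finite {xs. linear_extension A xs}"
  by (rule finite_subset[OF _ finite_lists_length_eq[of A "card A"]])
    (auto simp: linear_extension_distinct distinct_card[symmetric], auto simp: linear_extension_def)

text \<open>The list is built from the front, starting with a minimal element \<open>m\<close> among
  those of least value: anything else below \<open>m\<close> would also have least value, against
  minimality. The codomain is general because both real maps and ranks in a chain of ideals are
  sorted in this way.\<close>

lemma ex_sorted_linear_extension:
  fixes f :: "'a::order \<Rightarrow> 'b::linorder"
  assumes "finite A" "mono_on A f"
  shows "\<exists>xs. linear_extension A xs \<and> sorted (map f xs)"
  using assms
proof (induction A rule: finite_psubset_induct)
  case (psubset A)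
  show ?case
  proof (cases "A = {}")
    case True
    then show ?thesis by (auto simp: linear_extension_def)
  next
    case False
    define B where "B = {a \<in> A. f a = Min (f ` A)}"
    have "Min (f ` A) \<in> f ` A" using psubset(1) False by (intro Min_in) auto
    then have "finite B" "B \<noteq> {}" using psubset(1) by (auto simp: B_def)
    then obtain m where m: "m \<in> B" "\<And>b. b \<in> B \<Longrightarrow> b \<le> m \<Longrightarrow> m = b"
      using finite_has_minimal[of B] by blast
    have mA: "m \<in> A" and fm: "\<And>b. b \<in> A \<Longrightarrow> f m \<le> f b"
      using m(1) psubset(1) by (auto simp: B_def)
    have least: "\<not> b \<le> m" if "b \<in> A - {m}" for b
    proof
      assume "b \<le> m"
      then have "f b \<le> f m" using psubset.prems that mA by (auto simp: mono_on_def)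
      then have "f b = f m" using fm[of b] that by (intro antisym) auto
      then have "b \<in> B" using m(1) that by (auto simp: B_def)
      then show False using m(2) \<open>b \<le> m\<close> that by blast
    qed
    have "\<exists>xs. linear_extension (A - {m}) xs \<and> sorted (map f xs)"
      using mA psubset.prems by (intro psubset.IH) (auto intro: mono_on_subset)
    then obtain xs where "linear_extension (A - {m}) xs" "sorted (map f xs)" by blast
    then have "linear_extension A (m # xs) \<and> sorted (map f (m # xs))"
      using least fm mA by (auto simp: linear_extension_def)
    then show ?thesis by blast
  qed
qed

lemma sorted_chamber_mono:
  assumes "linear_extension A xs" "sorted (map l xs)"
  shows "mono_on A l"
proof (rule mono_onI)
  fix a b assume "a \<in> A" "b \<in> A" "a \<le> b"
  then obtain i j where ij: "i < length xs" "j < length xs" "xs ! i = a" "xs ! j = b"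
    using assms(1) by (auto simp: linear_extension_def in_set_conv_nth)
  have "\<not> j < i"
    using assms(1) ij \<open>a \<le> b\<close> by (auto simp: linear_extension_def sorted_wrt_iff_nth_less)
  then show "l a \<le> l b"
    using sorted_nth_mono[OF assms(2), of i j] ij by simp
qed

lemma Union_chambers:
  assumes "finite A"
  shows "\<Union>(chamber A ` {xs. linear_extension A xs}) = order_cone A"
proof
  show "\<Union>(chamber A ` {xs. linear_extension A xs}) \<subseteq> order_cone A"
    by (auto simp: chamber_def order_cone_def intro: sorted_chamber_mono)
  show "order_cone A \<subseteq> \<Union>(chamber A ` {xs. linear_extension A xs})"
    using ex_sorted_linear_extension[OF assms] by (force simp: chamber_def order_cone_def)
qed

lemma polyhedral_cone_chamber:
  assumes "finite A" "set xs = A"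
  shows "polyhedral_cone A (chamber A xs)"
proof -
  \<comment> \<open>The functional \<open>x (xs ! Suc k) - x (xs ! k)\<close>. Comparing consecutive
    entries suffices for sortedness, so finitely many functionals cut out the chamber.\<close>
  define h :: "nat \<Rightarrow> 'a \<Rightarrow> real" where
    "h k = (\<lambda>a. (if a = xs ! Suc k then 1 else 0) - (if a = xs ! k then 1 else 0))" for k
  have h: "(\<Sum>a\<in>A. h k a * x a) = x (xs ! Suc k) - x (xs ! k)" if "Suc k < length xs" for x k
  proof -
    have eq: "h k a * x a = (if a = xs ! Suc k then x a else 0) - (if a = xs ! k then x a else 0)" for a
      by (simp add: h_def)
    have "xs ! Suc k \<in> A" "xs ! k \<in> A" using that assms(2) by auto
    then show ?thesis
      using assms(1) unfolding eq sum_subtractf by (simp add: sum.delta)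
  qed
  have "chamber A xs = {x \<in> A \<rightarrow>\<^sub>E UNIV. \<forall>g\<in>h ` {k. Suc k < length xs}. 0 \<le> (\<Sum>a\<in>A. g a * x a)}"
    by (auto simp: chamber_def sorted_iff_nth_Suc h)
  moreover have "finite (h ` {k. Suc k < length xs})"
    by (intro finite_imageI, rule finite_subset[of _ "{..<length xs}"]) auto
  ultimately show ?thesis unfolding polyhedral_cone_def by blast
qed

text \<open>Ideals are down-closed, so the index \<open>r a\<close> of the first ideal containing
  \<open>a\<close> is order preserving. A linear extension sorted by \<open>r\<close> lists the
  blocks one after another, and the values of a map in the cell increase weakly from block to
  block.\<close>

lemma cell_subset_chamber:
  assumes "finite A" "ideal_chain A k I"
  shows "\<exists>xs. linear_extension A xs \<and> cell A k I \<subseteq> chamber A xs"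
proof -
  define r where "r a = (LEAST j. a \<in> I j)" for a
  have rk: "r a \<le> k" and rI: "a \<in> I (r a)" if "a \<in> A" for a
  proof -
    have "a \<in> I k" using assms(2) that by (simp add: ideal_chain_def)
    then show "r a \<le> k" "a \<in> I (r a)" unfolding r_def by (rule Least_le, rule LeastI)
  qed
  \<comment> \<open>Since \<open>r a\<close> is least, \<open>a\<close> is missing from the
    preceding ideal and so lies in the block with index \<open>r a\<close>.\<close>
  have rb: "a \<in> block I (r a)" if "a \<in> A" for a
  proof (cases "r a")
    case 0
    then show ?thesis using rI[OF that] by (simp add: block_def)
  next
    case (Suc i)
    then have "a \<notin> I i" using not_less_Least[of i "\<lambda>j. a \<in> I j"] by (simp add: r_def)
    then show ?thesis using rI[OF that] Suc by (simp add: block_def)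
  qed
  have "mono_on A r"
  proof (rule mono_onI)
    fix a b assume ab: "a \<in> A" "b \<in> A" "a \<le> b"
    have "order_ideal A (I (r b))" using assms(2) rk[OF ab(2)] by (simp add: ideal_chain_def)
    then have "a \<in> I (r b)" using ab rI[OF ab(2)] unfolding order_ideal_def by blast
    then show "r a \<le> r b" unfolding r_def[of a] by (rule Least_le)
  qed
  then obtain xs where xs: "linear_extension A xs" "sorted (map r xs)"
    using ex_sorted_linear_extension[OF assms(1)] by blast
  have "x \<in> chamber A xs" if x: "x \<in> cell A k I" for x
  proof -
    obtain c where c: "\<And>j a. j \<le> k \<Longrightarrow> a \<in> block I j \<Longrightarrow> x a = c j" "\<And>j. j < k \<Longrightarrow> c j \<le> c (Suc j)"
      using x unfolding cell_def by blast
    have cm: "c i \<le> c j" if "i \<le> j" "j \<le> k" for i j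
      using that
    proof (induction j rule: dec_induct)
      case (step n)
      then show ?case using c(2)[of n] by simp
    qed simp
    have "x a \<le> x b" if "a \<in> A" "b \<in> A" "r a \<le> r b" for a b
    proof -
      have "x a = c (r a)" "x b = c (r b)" using that by (auto intro!: c(1) rk rb)
      then show ?thesis using cm[OF that(3) rk[OF that(2)]] by simp
    qed
    then have "sorted_wrt (\<lambda>a b. x a \<le> x b) xs"
      using xs by (intro sorted_wrt_mono_rel[of xs "\<lambda>a b. r a \<le> r b" "\<lambda>a b. x a \<le> x b"])
        (auto simp: sorted_wrt_map linear_extension_def)
    then have "sorted (map x xs)" by (simp add: sorted_wrt_map)
    then show ?thesis using x by (simp add: chamber_def cell_def)
  qed
  then show ?thesis using xs(1) by blast
qed

section \<open>Counting one element at a time\<close>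

lemma Omega_self:
  assumes "l \<in> A \<rightarrow>\<^sub>E \<int>" "mono_on A l"
  shows "Omega A A l = 1"
proof -
  have "marked_order_polytope A A l \<inter> (A \<rightarrow>\<^sub>E \<int>) = {l}"
    using assms by (auto simp: marked_order_polytope_def PiE_iff intro: extensionalityI dest: extensional_arb)
  then show ?thesis by (simp add: Omega_def)
qed

text \<open>Slices the lattice points by their value at \<open>p\<close>, an integer confined by the
  marked values at \<open>a\<close> and \<open>b\<close>. The slices are finite and disjoint, so
  their cardinalities add up.\<close>

lemma Omega_sum:
  assumes fin: "finite P" and sub: "A \<subseteq> P" and mm: "min_elems P \<union> max_elems P \<subseteq> A"
    and p: "p \<in> P - A" and ab: "a \<in> A" "b \<in> A" "a \<le> p" "p \<le> b"
  shows "Omega P A l = (\<Sum>v\<in>{\<lfloor>l a\<rfloor>..\<lfloor>l b\<rfloor>}. Omega P (insert p A) (l(p := of_int v)))"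
proof -
  define M where "M v = marked_order_polytope P (insert p A) (l(p := of_int v)) \<inter> (P \<rightarrow>\<^sub>E \<int>)" for v
  have Mp: "\<phi> p = of_int v" if "\<phi> \<in> M v" for \<phi> v
    using that by (auto simp: M_def marked_order_polytope_def)
  have "marked_order_polytope P A l \<inter> (P \<rightarrow>\<^sub>E \<int>) = (\<Union>v\<in>{\<lfloor>l a\<rfloor>..\<lfloor>l b\<rfloor>}. M v)"
  proof (intro subset_antisym subsetI)
    fix \<phi> assume \<phi>: "\<phi> \<in> marked_order_polytope P A l \<inter> (P \<rightarrow>\<^sub>E \<int>)"
    then have "\<phi> p \<in> \<int>" using p by auto
    then obtain v where v: "\<phi> p = of_int v" by (auto elim: Ints_cases)
    have "mono_on P \<phi>" "\<phi> a = l a" "\<phi> b = l b"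
      using \<phi> ab by (auto simp: marked_order_polytope_def)
    moreover from this(1) have "\<phi> a \<le> \<phi> p" "\<phi> p \<le> \<phi> b"
      using p ab sub by (auto intro: mono_onD)
    ultimately have "l a \<le> of_int v" "of_int v \<le> l b" using v by simp_all
    then have "v \<in> {\<lfloor>l a\<rfloor>..\<lfloor>l b\<rfloor>}" by (simp add: le_floor_iff floor_le_iff)
    moreover have "\<phi> \<in> M v" using \<phi> v by (auto simp: M_def marked_order_polytope_def)
    ultimately show "\<phi> \<in> (\<Union>v\<in>{\<lfloor>l a\<rfloor>..\<lfloor>l b\<rfloor>}. M v)" by blast
  next
    fix \<phi> assume "\<phi> \<in> (\<Union>v\<in>{\<lfloor>l a\<rfloor>..\<lfloor>l b\<rfloor>}. M v)"
    then show "\<phi> \<in> marked_order_polytope P A l \<inter> (P \<rightarrow>\<^sub>E \<int>)"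
      using p by (auto simp: M_def marked_order_polytope_def split: if_splits)
  qed
  moreover have "finite (M v)" for v
    unfolding M_def using sub mm p by (intro finite_lattice_points[OF fin]) auto
  moreover have "M v \<inter> M w = {}" if "v \<noteq> w" for v w
  proof -
    have False if "\<phi> \<in> M v" "\<phi> \<in> M w" for \<phi>
      using Mp[OF that(1)] Mp[OF that(2)] \<open>v \<noteq> w\<close> by simp
    then show ?thesis by blast
  qed
  ultimately show ?thesis
    by (simp add: Omega_def M_def[symmetric] card_UN_disjoint)
qed

text \<open>Only pairs involving \<open>p\<close> need a check, as the other elements keep their
  relative order.\<close>

lemma linear_extension_insert:
  assumes lin: "linear_extension A xs" and p: "p \<notin> A"
    and below: "\<And>m. m < n \<Longrightarrow> m < length xs \<Longrightarrow> \<not> p \<le> xs ! m"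
    and above: "\<And>m. n \<le> m \<Longrightarrow> m < length xs \<Longrightarrow> \<not> xs ! m \<le> p"
  shows "linear_extension (insert p A) (take n xs @ p # drop n xs)"
proof -
  have "sorted_wrt (\<lambda>a b. \<not> b \<le> a) (take n xs @ drop n xs)" "set (take n xs @ drop n xs) = A"
    using lin by (auto simp: linear_extension_def)
  moreover have "\<forall>a\<in>set (take n xs). \<not> p \<le> a"
    using below by (auto simp: in_set_conv_nth)
  moreover have "\<forall>a\<in>set (drop n xs). \<not> a \<le> p"
    using above by (auto simp: in_set_conv_nth)
  moreover have "set (take n xs @ p # drop n xs) = insert p (set (take n xs @ drop n xs))"
    by (simp only: set_append list.set) blast
  ultimately show ?thesis
    unfolding linear_extension_def sorted_wrt_append by auto
qed

text \<open>The counterpart of \<open>linear_extension_insert\<close> for values: a value in the gap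
  after \<open>xs ! k\<close> puts the extended map into the chamber of the list with
  \<open>p\<close> inserted at that gap.\<close>

lemma sorted_map_insert:
  fixes l :: "'a \<Rightarrow> real"
  assumes "sorted (map l xs)" "p \<notin> set xs" "Suc k < length xs" "l (xs ! k) \<le> v" "v \<le> l (xs ! Suc k)"
  shows "sorted (map (l(p := v)) (take (Suc k) xs @ p # drop (Suc k) xs))"
proof -
  have eq: "map (l(p := v)) ys = map l ys" if "set ys \<subseteq> set xs" for ys
    using that assms(2) by auto
  have t: "map (l(p := v)) (take (Suc k) xs) = map l (take (Suc k) xs)"
    by (rule eq) (rule set_take_subset)
  have d: "map (l(p := v)) (drop (Suc k) xs) = map l (drop (Suc k) xs)"
    by (rule eq) (rule set_drop_subset)
  have s: "sorted (map l (take (Suc k) xs) @ map l (drop (Suc k) xs))"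
    using assms(1) by (simp flip: map_append)
  have "l a \<le> v" if "a \<in> set (take (Suc k) xs)" for a
  proof -
    obtain m where m: "m \<le> k" "a = xs ! m" "m < length xs" using \<open>a \<in> _\<close> by (auto simp: in_set_conv_nth less_Suc_eq_le)
    then show ?thesis using sorted_nth_mono[OF assms(1), of m k] assms(3,4) by simp
  qed
  moreover have "v \<le> l a" if "a \<in> set (drop (Suc k) xs)" for a
  proof -
    obtain m where m: "a = xs ! (Suc k + m)" "Suc k + m < length xs"
      using \<open>a \<in> _\<close> by (auto simp: in_set_conv_nth)
    then show ?thesis using sorted_nth_mono[OF assms(1), of "Suc k" "Suc k + m"] assms(3,5) by simp
  qed
  ultimately show ?thesis
    using s unfolding map_append list.map t d sorted_append by auto
qed

text \<open>Induction over all \<open>A\<close> and \<open>xs\<close> at once, since marking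
  \<open>p\<close> changes both. When everything is marked, the count is constantly 1.\<close>

lemma Omega_polyfun_chamber:
  fixes P A :: "'a::order set"
  assumes fin: "finite P" and "A \<subseteq> P" "min_elems P \<union> max_elems P \<subseteq> A" "linear_extension A xs"
  shows "\<exists>F\<in>polyfun A. \<forall>l\<in>chamber A xs \<inter> (A \<rightarrow>\<^sub>E \<int>). real (Omega P A l) = F l"
  using assms(2-)
proof (induction "card (P - A)" arbitrary: A xs rule: less_induct)
  case less
  note sub = less.prems(1) and mm = less.prems(2) and lin = less.prems(3)
  show ?case
  proof (cases "A = P")
    case True
    have "real (Omega P A l) = 1" if "l \<in> chamber A xs \<inter> (A \<rightarrow>\<^sub>E \<int>)" for l
      using that Omega_self sorted_chamber_mono[OF lin] True by (auto simp: chamber_def)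
    then show ?thesis by (intro bexI[of _ "\<lambda>_. 1"] polyfun.const) auto
  next
    case False
    then obtain p where p: "p \<in> P" "p \<notin> A" using sub by blast
    have setxs: "set xs = A" using lin by (simp add: linear_extension_def)
    define S where "S = {k. k < length xs \<and> xs ! k \<le> p}"
    define T where "T = {k. k < length xs \<and> p \<le> xs ! k}"
    have "finite S" "finite T" by (auto simp: S_def T_def)
    \<comment> \<open>A minimal element of \<open>P\<close> below \<open>p\<close> and a maximal one
      above it are marked, so \<open>S\<close> and \<open>T\<close> are nonempty.\<close>
    obtain a where a: "a \<in> P" "a \<le> p" "\<forall>y\<in>P. y \<le> a \<longrightarrow> a = y"
      using finite_has_minimal2[OF fin p(1)] by blast
    obtain b where b: "b \<in> P" "p \<le> b" "\<forall>y\<in>P. b \<le> y \<longrightarrow> b = y"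
      using finite_has_maximal2[OF fin p(1)] by blast
    have "a \<in> A" "b \<in> A" using a b mm by (auto simp: min_elems_def max_elems_def)
    then have "S \<noteq> {}" "T \<noteq> {}"
      using a(2) b(2) setxs by (fastforce simp: S_def T_def in_set_conv_nth)+
    define i where "i = Max S"
    define j where "j = Min T"
    have "i \<in> S" "j \<in> T"
      using \<open>finite S\<close> \<open>finite T\<close> \<open>S \<noteq> {}\<close> \<open>T \<noteq> {}\<close> by (simp_all add: i_def j_def)
    then have i: "i < length xs" "xs ! i \<le> p" and j: "j < length xs" "p \<le> xs ! j"
      by (auto simp: S_def T_def)
    have xsA: "xs ! k \<in> A" if "k < length xs" for k
      using that setxs by auto
    \<comment> \<open>Equality would force \<open>p\<close> to be marked by antisymmetry;
      \<open>j < i\<close> would give \<open>xs ! i \<le> p \<le> xs ! j\<close> against the linear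
      extension.\<close>
    have "i < j"
    proof (rule ccontr)
      assume "\<not> i < j"
      then consider "i = j" | "j < i" by linarith
      then show False
      proof cases
        case 1
        then have "xs ! i = p" using i j by auto
        then show False using xsA[OF i(1)] p by simp
      next
        case 2
        then have "\<not> xs ! i \<le> xs ! j"
          using lin i by (auto simp: linear_extension_def sorted_wrt_iff_nth_less)
        then show False using i(2) j(2) by (meson order_trans)
      qed
    qed
    \<comment> \<open>Each gap between positions \<open>i\<close> and \<open>j\<close> admits
      \<open>p\<close>, and the induction hypothesis for the enlarged list yields one polynomial for
      it, valid up to both ends of the gap.\<close>
    have "\<exists>f\<in>polyfun (insert p A). \<forall>l\<in>chamber A xs \<inter> (A \<rightarrow>\<^sub>E \<int>). \<forall>v.
        l (xs ! k) \<le> of_int v \<longrightarrow> of_int v \<le> l (xs ! Suc k) \<longrightarrow>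
        real (Omega P (insert p A) (l(p := of_int v))) = f (l(p := of_int v))"
      if k: "i \<le> k" "k < j" for k
    proof -
      let ?ys = "take (Suc k) xs @ p # drop (Suc k) xs"
      have "linear_extension (insert p A) ?ys"
      proof (rule linear_extension_insert[OF lin p(2)])
        fix m assume m: "m < length xs"
        show "\<not> p \<le> xs ! m" if "m < Suc k"
        proof
          assume "p \<le> xs ! m"
          then have "j \<le> m" using m \<open>finite T\<close> by (auto simp: j_def T_def)
          then show False using that k by simp
        qed
        show "\<not> xs ! m \<le> p" if "Suc k \<le> m"
        proof
          assume "xs ! m \<le> p"
          then have "m \<le> i" using m \<open>finite S\<close> by (auto simp: i_def S_def)
          then show False using that k by simp
        qed
      qed
      moreover have "card (P - insert p A) < card (P - A)"
        using fin p by (intro psubset_card_mono) auto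
      ultimately obtain f where f: "f \<in> polyfun (insert p A)"
        "\<And>l. l \<in> chamber (insert p A) ?ys \<Longrightarrow> l \<in> insert p A \<rightarrow>\<^sub>E \<int> \<Longrightarrow>
          real (Omega P (insert p A) l) = f l"
        using less.hyps[of "insert p A" ?ys] p sub mm by blast
      have "real (Omega P (insert p A) (l(p := of_int v))) = f (l(p := of_int v))"
        if l: "l \<in> chamber A xs \<inter> (A \<rightarrow>\<^sub>E \<int>)" and v: "l (xs ! k) \<le> of_int v" "of_int v \<le> l (xs ! Suc k)" for l v
      proof (rule f(2))
        show Z: "l(p := of_int v) \<in> insert p A \<rightarrow>\<^sub>E \<int>"
          using l by (auto simp: PiE_iff extensional_def)
        have "sorted (map (l(p := of_int v)) ?ys)"
          using l v k j(1) p setxs by (intro sorted_map_insert) (auto simp: chamber_def)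
        then show "l(p := of_int v) \<in> chamber (insert p A) ?ys"
          using Z unfolding chamber_def by (auto simp: PiE_iff)
      qed
      then show ?thesis using f(1) by blast
    qed
    then obtain f where f: "\<And>k. i \<le> k \<Longrightarrow> k < j \<Longrightarrow> f k \<in> polyfun (insert p A)"
      "\<And>k l v. i \<le> k \<Longrightarrow> k < j \<Longrightarrow> l \<in> chamber A xs \<inter> (A \<rightarrow>\<^sub>E \<int>) \<Longrightarrow> l (xs ! k) \<le> of_int v \<Longrightarrow>
        of_int v \<le> l (xs ! Suc k) \<Longrightarrow>
        real (Omega P (insert p A) (l(p := of_int v))) = f k (l(p := of_int v))"
      by metis
    have Z: "l (xs ! k) \<in> \<int>" if "l \<in> chamber A xs \<inter> (A \<rightarrow>\<^sub>E \<int>)" "k < length xs" for l k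
      using that xsA by auto
    have le: "l (xs ! k) \<le> l (xs ! m)" if "l \<in> chamber A xs \<inter> (A \<rightarrow>\<^sub>E \<int>)" "k \<le> m" "m < length xs" for l k m
      using that sorted_nth_mono[of "map l xs" k m] by (auto simp: chamber_def)
    \<comment> \<open>The gaps are summed successively, with half-open ranges so that a shared
      marked value is counted once.\<close>
    have "\<exists>F\<in>polyfun A. \<forall>l\<in>chamber A xs \<inter> (A \<rightarrow>\<^sub>E \<int>).
        (\<Sum>v\<in>{\<lfloor>l (xs ! i)\<rfloor>..<\<lfloor>l (xs ! k)\<rfloor>}. real (Omega P (insert p A) (l(p := of_int v)))) = F l"
      if "i \<le> k" "k \<le> j" for k
      using that
    proof (induction k rule: dec_induct)
      case base
      show ?case by (intro bexI[of _ "\<lambda>_. 0"] polyfun.const) auto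
    next
      case (step k)
      let ?g = "\<lambda>l v. real (Omega P (insert p A) (l(p := of_int v)))"
      have k: "i \<le> k" "k < j" "Suc k < length xs" using step j by auto
      from step obtain F where F: "F \<in> polyfun A"
        "\<And>l. l \<in> chamber A xs \<inter> (A \<rightarrow>\<^sub>E \<int>) \<Longrightarrow> (\<Sum>v\<in>{\<lfloor>l (xs ! i)\<rfloor>..<\<lfloor>l (xs ! k)\<rfloor>}. ?g l v) = F l"
        by (meson Suc_leD)
      obtain G where G: "G \<in> polyfun A"
        "\<And>l. l (xs ! k) \<in> \<int> \<Longrightarrow> l (xs ! Suc k) \<in> \<int> \<Longrightarrow> l (xs ! k) \<le> l (xs ! Suc k) \<Longrightarrow>
          (\<Sum>v\<in>{\<lfloor>l (xs ! k)\<rfloor>..<\<lfloor>l (xs ! Suc k)\<rfloor>}. f k (l(p := of_int v))) = G l"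
        using polyfun_sum[OF f(1)[OF k(1,2)] p(2) xsA[of k] xsA[of "Suc k"]] k by auto
      have "(\<Sum>v\<in>{\<lfloor>l (xs ! i)\<rfloor>..<\<lfloor>l (xs ! Suc k)\<rfloor>}. ?g l v) = F l + G l"
        if l: "l \<in> chamber A xs \<inter> (A \<rightarrow>\<^sub>E \<int>)" for l
      proof -
        have "\<lfloor>l (xs ! i)\<rfloor> \<le> \<lfloor>l (xs ! k)\<rfloor>" "\<lfloor>l (xs ! k)\<rfloor> \<le> \<lfloor>l (xs ! Suc k)\<rfloor>"
          using k le[OF l] by (auto intro!: floor_mono)
        then have "{\<lfloor>l (xs ! i)\<rfloor>..<\<lfloor>l (xs ! Suc k)\<rfloor>} =
          {\<lfloor>l (xs ! i)\<rfloor>..<\<lfloor>l (xs ! k)\<rfloor>} \<union> {\<lfloor>l (xs ! k)\<rfloor>..<\<lfloor>l (xs ! Suc k)\<rfloor>}"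
          by auto
        then have "(\<Sum>v\<in>{\<lfloor>l (xs ! i)\<rfloor>..<\<lfloor>l (xs ! Suc k)\<rfloor>}. ?g l v)
          = F l + (\<Sum>v\<in>{\<lfloor>l (xs ! k)\<rfloor>..<\<lfloor>l (xs ! Suc k)\<rfloor>}. ?g l v)"
          by (simp add: sum.union_disjoint F(2)[OF l, symmetric] ivl_disj_int)
        also have "(\<Sum>v\<in>{\<lfloor>l (xs ! k)\<rfloor>..<\<lfloor>l (xs ! Suc k)\<rfloor>}. ?g l v)
          = (\<Sum>v\<in>{\<lfloor>l (xs ! k)\<rfloor>..<\<lfloor>l (xs ! Suc k)\<rfloor>}. f k (l(p := of_int v)))"
        proof (rule sum.cong[OF refl])
          fix v assume v: "v \<in> {\<lfloor>l (xs ! k)\<rfloor>..<\<lfloor>l (xs ! Suc k)\<rfloor>}"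
          \<comment> \<open>Marked values are integers here, so taking floors loses nothing and the
            bounds on \<open>v\<close> become bounds between reals.\<close>
          have "l (xs ! k) = of_int \<lfloor>l (xs ! k)\<rfloor>" "l (xs ! Suc k) = of_int \<lfloor>l (xs ! Suc k)\<rfloor>"
            using Z[OF l] k by auto
          then have "l (xs ! k) \<le> of_int v" "of_int v \<le> l (xs ! Suc k)"
            using v by (metis atLeastLessThan_iff of_int_le_iff less_imp_le)+
          then show "?g l v = f k (l(p := of_int v))" using f(2) k l by blast
        qed
        also have "\<dots> = G l" using k Z[OF l] le[OF l] by (intro G(2)) auto
        finally show ?thesis .
      qed
      then show ?case by (intro bexI[OF _ polyfun.add[OF F(1) G(1)]] ballI)
    qed
    then obtain F where F: "F \<in> polyfun A" "\<And>l. l \<in> chamber A xs \<inter> (A \<rightarrow>\<^sub>E \<int>) \<Longrightarrow>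
        (\<Sum>v\<in>{\<lfloor>l (xs ! i)\<rfloor>..<\<lfloor>l (xs ! j)\<rfloor>}. real (Omega P (insert p A) (l(p := of_int v)))) = F l"
      using \<open>i < j\<close> by (meson less_imp_le order_refl)
    \<comment> \<open>The half-open ranges omit the top value \<open>l (xs ! j)\<close>. Its term is
      added separately, using the polynomial of the last gap \<open>k\<close> with
      \<open>l (xs ! j)\<close> substituted for \<open>p\<close>.\<close>
    obtain k where k: "j = Suc k" "i \<le> k" using \<open>i < j\<close> by (cases j) auto
    have "real (Omega P A l) = F l + f k (l(p := l (xs ! j)))"
      if l: "l \<in> chamber A xs \<inter> (A \<rightarrow>\<^sub>E \<int>)" for l
    proof -
      have lj: "of_int \<lfloor>l (xs ! j)\<rfloor> = l (xs ! j)" using Z[OF l j(1)] by simp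
      have "\<lfloor>l (xs ! i)\<rfloor> \<le> \<lfloor>l (xs ! j)\<rfloor>" using le[OF l] \<open>i < j\<close> j by (auto intro!: floor_mono)
      then have eq: "{\<lfloor>l (xs ! i)\<rfloor>..\<lfloor>l (xs ! j)\<rfloor>} = insert \<lfloor>l (xs ! j)\<rfloor> {\<lfloor>l (xs ! i)\<rfloor>..<\<lfloor>l (xs ! j)\<rfloor>}"
        by auto
      have "real (Omega P A l) = (\<Sum>v\<in>{\<lfloor>l (xs ! i)\<rfloor>..\<lfloor>l (xs ! j)\<rfloor>}. real (Omega P (insert p A) (l(p := of_int v))))"
        using Omega_sum[OF fin sub mm _ xsA[OF i(1)] xsA[OF j(1)] i(2) j(2)] p by simp
      also have "\<dots> = F l + real (Omega P (insert p A) (l(p := of_int \<lfloor>l (xs ! j)\<rfloor>)))"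
        unfolding eq by (simp add: F(2)[OF l, symmetric])
      also have "\<dots> = F l + f k (l(p := of_int \<lfloor>l (xs ! j)\<rfloor>))"
      proof -
        have "l (xs ! k) \<le> of_int \<lfloor>l (xs ! j)\<rfloor>" "of_int \<lfloor>l (xs ! j)\<rfloor> \<le> l (xs ! Suc k)"
          using le[OF l, of k j] j(1) k(1) unfolding lj by simp_all
        then show ?thesis using f(2)[OF k(2) _ l] k(1) by simp
      qed
      finally show ?thesis by (simp only: lj)
    qed
    moreover have "(\<lambda>l. F l + f k (l(p := l (xs ! j)))) \<in> polyfun A"
      using F(1) f(1)[of k] k xsA[OF j(1)] by (intro polyfun.add polyfun_subst) auto
    ultimately show ?thesis by (intro bexI) auto
  qed
qed

text \<open>One formal polynomial per chamber serves both claims: the chambers are the pieces of the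
  order cone, and a cell inherits the polynomial of a chamber containing it.\<close>

theorem theorem2p6:
  fixes P A :: "'a::order set"
  assumes "finite P" and "A \<subseteq> P" and "min_elems P \<union> max_elems P \<subseteq> A"
  shows "piecewise_polynomial_over A (order_cone A) (\<lambda>l. real (Omega P A l)) \<and>
    (\<forall>k I. ideal_chain A k I \<longrightarrow>
       (\<exists>p\<in>polynomials_over A. \<forall>l\<in>cell A k I \<inter> (A \<rightarrow>\<^sub>E \<int>).
          real (Omega P A l) = poly_eval p l))"
proof (intro conjI allI impI)
  have finA: "finite A" using assms finite_subset by blast
  have poly: "\<exists>p\<in>polynomials_over A. \<forall>l\<in>chamber A xs \<inter> (A \<rightarrow>\<^sub>E \<int>). real (Omega P A l) = poly_eval p l"
    if "linear_extension A xs" for xs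
    using Omega_polyfun_chamber[OF assms that] polyfun_poly_eval by metis
  show "piecewise_polynomial_over A (order_cone A) (\<lambda>l. real (Omega P A l))"
    unfolding piecewise_polynomial_over_def
  proof (intro exI[of _ "chamber A ` {xs. linear_extension A xs}"] conjI ballI)
    fix D assume "D \<in> chamber A ` {xs. linear_extension A xs}"
    then obtain xs where xs: "linear_extension A xs" "D = chamber A xs" by blast
    show "polyhedral_cone A D"
      using xs polyhedral_cone_chamber[OF finA] by (simp add: linear_extension_def)
    show "\<exists>p\<in>polynomials_over A. \<forall>x\<in>D \<inter> (A \<rightarrow>\<^sub>E \<int>). real (Omega P A x) = poly_eval p x"
      using poly xs by blast
  qed (simp_all add: finA finite_linear_extensions Union_chambers)
  fix k I assume "ideal_chain A k I"
  then obtain xs where xs: "linear_extension A xs" "cell A k I \<subseteq> chamber A xs"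
    using cell_subset_chamber[OF finA] by blast
  then show "\<exists>p\<in>polynomials_over A. \<forall>l\<in>cell A k I \<inter> (A \<rightarrow>\<^sub>E \<int>). real (Omega P A l) = poly_eval p l"
    using poly[OF xs(1)] by blast
qed

end
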